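(* Let $\mathcal{A},\mathcal{C}$ be complete categories and $A\colon\mathcal{A}\to\mathcal{A}$, $B\colon\mathcal{C}\to\mathcal{C}$ endofunctors. Suppose the right Kan extension $\mathrm{Ran}_{\bar A}\bar B$ (with counit $\epsilon$) exists and $B$ preserves it. Then there is a natural transformation $\tau\colon(\mathrm{Ran}_{\bar A}\bar B)A\Rightarrow B(\mathrm{Ran}_{\bar A}\bar B)$ such that $(\mathrm{Ran}_{\bar A}\bar B,\tau)$ is the companion of $(A,B)$, i.e. a final object of $\mathrm{DL}(A,B)$.
   Context: Final sequence: for an endofunctor $B$ on a complete category, $B_0=1$, $B_{i+1}=BB_i$, $B_j=\lim_{i<j}B_i$ for limit $j$, with connecting maps $B_{j,i}\colon B_j\to B_i$ satisfying $B_{i,i}=\mathrm{id}$, $B_{j+1,i+1}=BB_{j,i}$ and limit cones at limit ordinals; viewed as a functor $\bar B\colon\mathrm{Ord}^{op}\to\mathcal{C}$. For functors $F\colon\mathcal{X}\to\mathcal{D}$, $G\colon\mathcal{X}\to\mathcal{E}$, a right Kan extension of $G$ along $F$ is a pair $(\mathrm{Ran}_FG,\epsilon)$ with $\mathrm{Ran}_FG\colon\mathcal{D}\to\mathcal{E}$ and $\epsilon\colon(\mathrm{Ran}_FG)F\Rightarrow G$ such that for every $H\colon\mathcal{D}\to\mathcal{E}$ and $\alpha\colon HF\Rightarrow G$ there is a unique $\hat\alpha\colon H\Rightarrow\mathrm{Ran}_FG$ with $\epsilon\circ\hat\alpha F=\alpha$. A functor $K\colon\mathcal{E}\to\mathcal{F}$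 preserves it if $(K\circ\mathrm{Ran}_FG,K\epsilon)$ is a right Kan extension of $KG$ along $F$. $\mathrm{DL}(A,B)$: objects are pairs $(F,\lambda)$ with $F\colon\mathcal{A}\to\mathcal{C}$ a functor and $\lambda\colon FA\Rightarrow BF$ natural; morphisms $(F,\lambda)\to(G,\rho)$ are natural $\kappa\colon F\Rightarrow G$ with $\rho\circ\kappa A=B\kappa\circ\lambda$. The companion of $(A,B)$ is a final object of $\mathrm{DL}(A,B)$. *)

theory Defs
  imports Main "HOL-Library.FuncSet"
begin

text \<open>
  The classes \<^emph>\<open>Ord\<close> of ordinals and \<^emph>\<open>Set\<close> of small sets enter through a type parameter: a type of
  class \<open>ordinals\<close> plays the role of \<^emph>\<open>Ord\<close>. It is well-ordered, has no greatest element, and is not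
  equinumerous with any of its proper initial segments. A set is small if it is equinumerous with
  an ordinal. The usual notions are obtained by taking the ordinals of a Grothendieck universe; no
  closure property of the universe beyond the ones listed is imposed.
\<close>

class ordinals = wellorder +
  assumes no_last_ordinal: "\<exists>j. i < j"
    and Ord_not_small: "\<nexists>f. bij_betw f (UNIV :: 'a set) {i. i < j}"

definition small :: "'k::ordinals itself \<Rightarrow> 'a set \<Rightarrow> bool" where
  "small _ S \<longleftrightarrow> (\<exists>(j::'k) f. bij_betw f S {..<j})"

definition ozero :: "'k::ordinals" where
  "ozero = (LEAST i. True)"

definition osucc :: "'k::ordinals \<Rightarrow> 'k" where
  "osucc i = (LEAST j. i < j)"

definition limit_ordinal :: "'k::ordinals \<Rightarrow> bool" where
  "limit_ordinal j \<longleftrightarrow> j \<noteq> ozero \<and> (\<forall>i. j \<noteq> osucc i)"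


record ('o, 'm) cat =
  Obj :: "'o set"
  Arr :: "'m set"
  Dom :: "'m \<Rightarrow> 'o"
  Cod :: "'m \<Rightarrow> 'o"
  Ident :: "'o \<Rightarrow> 'm"
  Cmp :: "'m \<Rightarrow> 'm \<Rightarrow> 'm"  \<comment> \<open>\<open>Cmp C g f\<close> is \<open>g\<close> after \<open>f\<close>\<close>

definition hom :: "('o, 'm) cat \<Rightarrow> 'o \<Rightarrow> 'o \<Rightarrow> 'm set" where
  "hom C x y = {f \<in> Arr C. Dom C f = x \<and> Cod C f = y}"

locale category =
  fixes C :: "('o, 'm) cat"
  assumes Dom_in_Obj: "f \<in> Arr C \<Longrightarrow> Dom C f \<in> Obj C"
    and Cod_in_Obj: "f \<in> Arr C \<Longrightarrow> Cod C f \<in> Obj C"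
    and Id_in_hom: "x \<in> Obj C \<Longrightarrow> Ident C x \<in> hom C x x"
    and Cmp_in_hom: "f \<in> hom C x y \<Longrightarrow> g \<in> hom C y z \<Longrightarrow> Cmp C g f \<in> hom C x z"
    and Cmp_Id_left: "f \<in> hom C x y \<Longrightarrow> Cmp C (Ident C y) f = f"
    and Cmp_Id_right: "f \<in> hom C x y \<Longrightarrow> Cmp C f (Ident C x) = f"
    and Cmp_assoc: "f \<in> hom C w x \<Longrightarrow> g \<in> hom C x y \<Longrightarrow> h \<in> hom C y z
      \<Longrightarrow> Cmp C h (Cmp C g f) = Cmp C (Cmp C h g) f"

definition final_object :: "('o, 'm) cat \<Rightarrow> 'o \<Rightarrow> bool" where
  "final_object C t \<longleftrightarrow> t \<in> Obj C \<and> (\<forall>x\<in>Obj C. \<exists>!f. f \<in> hom C x t)"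


text \<open>
  Functors and natural transformations are extensional (\<^const>\<open>undefined\<close> off the domain), so that HOL
  equality is equality of functors and of natural transformations.
\<close>

record ('o1, 'm1, 'o2, 'm2) fct =
  fobj :: "'o1 \<Rightarrow> 'o2"
  farr :: "'m1 \<Rightarrow> 'm2"

definition is_functor :: "('o1, 'm1) cat \<Rightarrow> ('o2, 'm2) cat \<Rightarrow> ('o1, 'm1, 'o2, 'm2) fct \<Rightarrow> bool" where
  "is_functor C D F \<longleftrightarrow>
     fobj F \<in> Obj C \<rightarrow>\<^sub>E Obj D \<and>
     farr F \<in> Arr C \<rightarrow>\<^sub>E Arr D \<and>
     (\<forall>f\<in>Arr C. farr F f \<in> hom D (fobj F (Dom C f)) (fobj F (Cod C f))) \<and>
     (\<forall>x\<in>Obj C. farr F (Ident C x) = Ident D (fobj F x)) \<and>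
     (\<forall>f\<in>Arr C. \<forall>g\<in>Arr C. Cod C f = Dom C g \<longrightarrow>
        farr F (Cmp C g f) = Cmp D (farr F g) (farr F f))"

text \<open>\<open>functor_comp C G F\<close> is the composite \<open>G \<circ> F\<close>, where \<open>C\<close> is the domain of \<open>F\<close>.\<close>

definition functor_comp :: "('o1, 'm1) cat \<Rightarrow> ('o2, 'm2, 'o3, 'm3) fct \<Rightarrow> ('o1, 'm1, 'o2, 'm2) fct
    \<Rightarrow> ('o1, 'm1, 'o3, 'm3) fct" where
  "functor_comp C G F = \<lparr>fobj = compose (Obj C) (fobj G) (fobj F), farr = compose (Arr C) (farr G) (farr F)\<rparr>"

definition nat_trans :: "('o1, 'm1) cat \<Rightarrow> ('o2, 'm2) cat \<Rightarrow> ('o1, 'm1, 'o2, 'm2) fct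
    \<Rightarrow> ('o1, 'm1, 'o2, 'm2) fct \<Rightarrow> ('o1 \<Rightarrow> 'm2) \<Rightarrow> bool" where
  "nat_trans C D F G \<tau> \<longleftrightarrow>
     is_functor C D F \<and> is_functor C D G \<and>
     \<tau> \<in> (\<Pi>\<^sub>E x\<in>Obj C. hom D (fobj F x) (fobj G x)) \<and>
     (\<forall>f\<in>Arr C. Cmp D (\<tau> (Cod C f)) (farr F f) = Cmp D (farr G f) (\<tau> (Dom C f)))"

text \<open>
  For natural transformations between functors with domain \<open>C\<close>: vertical composition
  \<open>\<sigma> \<circ> \<tau>\<close> (with components in \<open>D\<close>), the whiskering \<open>\<tau>F\<close> and the whiskering \<open>K\<tau>\<close>.
\<close>

definition vcomp :: "('o1, 'm1) cat \<Rightarrow> ('o2, 'm2) cat \<Rightarrow> ('o1 \<Rightarrow> 'm2) \<Rightarrow> ('o1 \<Rightarrow> 'm2) \<Rightarrow> 'o1 \<Rightarrow> 'm2" where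
  "vcomp C D \<sigma> \<tau> = (\<lambda>x\<in>Obj C. Cmp D (\<sigma> x) (\<tau> x))"

definition whisker_right :: "('o1, 'm1) cat \<Rightarrow> ('o2 \<Rightarrow> 'm3) \<Rightarrow> ('o1, 'm1, 'o2, 'm2) fct \<Rightarrow> 'o1 \<Rightarrow> 'm3" where
  "whisker_right C \<tau> F = (\<lambda>x\<in>Obj C. \<tau> (fobj F x))"

definition whisker_left :: "('o1, 'm1) cat \<Rightarrow> ('o2, 'm2, 'o3, 'm3) fct \<Rightarrow> ('o1 \<Rightarrow> 'm2) \<Rightarrow> 'o1 \<Rightarrow> 'm3" where
  "whisker_left C K \<tau> = (\<lambda>x\<in>Obj C. farr K (\<tau> x))"


definition is_cone :: "('j, 'a) cat \<Rightarrow> ('o, 'm) cat \<Rightarrow> ('j, 'a, 'o, 'm) fct \<Rightarrow> 'o \<Rightarrow> ('j \<Rightarrow> 'm) \<Rightarrow> bool" where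
  "is_cone J C D c \<pi> \<longleftrightarrow>
     c \<in> Obj C \<and> \<pi> \<in> (\<Pi>\<^sub>E i\<in>Obj J. hom C c (fobj D i)) \<and>
     (\<forall>f\<in>Arr J. Cmp C (farr D f) (\<pi> (Dom J f)) = \<pi> (Cod J f))"

definition is_limit :: "('j, 'a) cat \<Rightarrow> ('o, 'm) cat \<Rightarrow> ('j, 'a, 'o, 'm) fct \<Rightarrow> 'o \<Rightarrow> ('j \<Rightarrow> 'm) \<Rightarrow> bool" where
  "is_limit J C D c \<pi> \<longleftrightarrow>
     is_cone J C D c \<pi> \<and>
     (\<forall>d \<sigma>. is_cone J C D d \<sigma> \<longrightarrow> (\<exists>!h. h \<in> hom C d c \<and> (\<forall>i\<in>Obj J. Cmp C (\<pi> i) h = \<sigma> i)))"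

text \<open>
  Every small category is isomorphic to one whose objects and arrows are ordinals, so index
  categories over the type of ordinals suffice.
\<close>

definition complete_category :: "'k::ordinals itself \<Rightarrow> ('o, 'm) cat \<Rightarrow> bool" where
  "complete_category K C \<longleftrightarrow>
     category C \<and>
     (\<forall>(J :: ('k, 'k) cat) D.
        category J \<and> small K (Obj J) \<and> small K (Arr J) \<and> is_functor J C D \<longrightarrow>
        (\<exists>c \<pi>. is_limit J C D c \<pi>))"


text \<open>
  The opposite of the full subcategory of \<^emph>\<open>Ord\<close> on \<open>I\<close>; the pair \<open>(j, i)\<close> with \<open>i \<le> j\<close> is the
  unique arrow from \<open>j\<close> to \<open>i\<close>.
\<close>

definition ord_op :: "'k::ordinals set \<Rightarrow> ('k, 'k \<times> 'k) cat" where
  "ord_op I = \<lparr>Obj = I, Arr = {(j, i). j \<in> I \<and> i \<in> I \<and> i \<le> j}, Dom = fst, Cod = snd,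
     Ident = (\<lambda>i. (i, i)), Cmp = (\<lambda>g f. (fst f, snd g))\<rparr>"

definition restrict_functor :: "('o1, 'm1) cat \<Rightarrow> ('o1, 'm1, 'o2, 'm2) fct \<Rightarrow> ('o1, 'm1, 'o2, 'm2) fct" where
  "restrict_functor J F = \<lparr>fobj = restrict (fobj F) (Obj J), farr = restrict (farr F) (Arr J)\<rparr>"

text \<open>
  Limits are determined only up to isomorphism: \<open>final_sequence C B S\<close> says that \<open>S\<close> is a final
  sequence of \<open>B\<close> for some choice of final object and limits.
\<close>

definition final_sequence :: "('o, 'm) cat \<Rightarrow> ('o, 'm, 'o, 'm) fct
    \<Rightarrow> ('k::ordinals, 'k \<times> 'k, 'o, 'm) fct \<Rightarrow> bool" where
  "final_sequence C B S \<longleftrightarrow>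
     is_functor (ord_op UNIV) C S \<and>
     final_object C (fobj S ozero) \<and>
     (\<forall>i. fobj S (osucc i) = fobj B (fobj S i)) \<and>
     (\<forall>i j. i \<le> j \<longrightarrow> farr S (osucc j, osucc i) = farr B (farr S (j, i))) \<and>
     (\<forall>j. limit_ordinal j \<longrightarrow>
        is_limit (ord_op {..<j}) C (restrict_functor (ord_op {..<j}) S)
          (fobj S j) (\<lambda>i\<in>{..<j}. farr S (j, i)))"


definition right_kan_extension :: "('ox, 'mx) cat \<Rightarrow> ('od, 'md) cat \<Rightarrow> ('oe, 'me) cat
    \<Rightarrow> ('ox, 'mx, 'od, 'md) fct \<Rightarrow> ('ox, 'mx, 'oe, 'me) fct
    \<Rightarrow> ('od, 'md, 'oe, 'me) fct \<Rightarrow> ('ox \<Rightarrow> 'me) \<Rightarrow> bool" where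
  "right_kan_extension X D E F G R \<epsilon> \<longleftrightarrow>
     is_functor X D F \<and> is_functor X E G \<and> is_functor D E R \<and>
     nat_trans X E (functor_comp X R F) G \<epsilon> \<and>
     (\<forall>H \<alpha>. is_functor D E H \<and> nat_trans X E (functor_comp X H F) G \<alpha> \<longrightarrow>
        (\<exists>!\<beta>. nat_trans D E H R \<beta> \<and> vcomp X E \<epsilon> (whisker_right X \<beta> F) = \<alpha>))"

text \<open>The functor \<open>K\<close>, with codomain \<open>E'\<close>, preserves the right Kan extension \<open>(R, \<epsilon>)\<close> of \<open>G\<close> along \<open>F\<close>.\<close>

definition preserves_right_kan_extension :: "('ox, 'mx) cat \<Rightarrow> ('od, 'md) cat \<Rightarrow> ('of, 'mf) cat
    \<Rightarrow> ('oe, 'me, 'of, 'mf) fct \<Rightarrow> ('ox, 'mx, 'od, 'md) fct \<Rightarrow> ('ox, 'mx, 'oe, 'me) fct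
    \<Rightarrow> ('od, 'md, 'oe, 'me) fct \<Rightarrow> ('ox \<Rightarrow> 'me) \<Rightarrow> bool" where
  "preserves_right_kan_extension X D E' K F G R \<epsilon> \<longleftrightarrow>
     right_kan_extension X D E' F (functor_comp X K G) (functor_comp D K R) (whisker_left X K \<epsilon>)"


text \<open>
  An arrow of \<open>DL\<close> is a natural transformation together with its source and target.
\<close>

type_synonym ('oa, 'ma, 'oc, 'mc) dlaw = "('oa, 'ma, 'oc, 'mc) fct \<times> ('oa \<Rightarrow> 'mc)"

definition DL :: "('oa, 'ma) cat \<Rightarrow> ('oc, 'mc) cat \<Rightarrow> ('oa, 'ma, 'oa, 'ma) fct \<Rightarrow> ('oc, 'mc, 'oc, 'mc) fct
    \<Rightarrow> (('oa, 'ma, 'oc, 'mc) dlaw,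
        ('oa, 'ma, 'oc, 'mc) dlaw \<times> ('oa \<Rightarrow> 'mc) \<times> ('oa, 'ma, 'oc, 'mc) dlaw) cat" where
  "DL \<A> \<C> A B = (let obj = {(F, lam). is_functor \<A> \<C> F \<and> nat_trans \<A> \<C> (functor_comp \<A> F A) (functor_comp \<A> B F) lam} in
     \<lparr>Obj = obj,
      Arr = {((F, lam), \<kappa>, (G, \<rho>)). (F, lam) \<in> obj \<and> (G, \<rho>) \<in> obj \<and> nat_trans \<A> \<C> F G \<kappa> \<and>
        vcomp \<A> \<C> \<rho> (whisker_right \<A> \<kappa> A) = vcomp \<A> \<C> (whisker_left \<A> B \<kappa>) lam},
      Dom = (\<lambda>(P, \<kappa>, Q). P),
      Cod = (\<lambda>(P, \<kappa>, Q). Q),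
      Ident = (\<lambda>(F, lam). ((F, lam), (\<lambda>x\<in>Obj \<A>. Ident \<C> (fobj F x)), (F, lam))),
      Cmp = (\<lambda>(Q', \<kappa>', S) (P, \<kappa>, Q). (P, vcomp \<A> \<C> \<kappa>' \<kappa>, S))\<rparr>)"

definition companion :: "('oa, 'ma) cat \<Rightarrow> ('oc, 'mc) cat \<Rightarrow> ('oa, 'ma, 'oa, 'ma) fct \<Rightarrow> ('oc, 'mc, 'oc, 'mc) fct
    \<Rightarrow> ('oa, 'ma, 'oc, 'mc) dlaw \<Rightarrow> bool" where
  "companion \<A> \<C> A B P \<longleftrightarrow> final_object (DL \<A> \<C> A B) P"

end

theory Submission
  imports Defs
begin

text \<open>
  Write \<open>R\<close> for the Kan extension. The shifted counit \<open>\<epsilon>\<^sub>i\<^sub>+\<^sub>1 : R A A\<^sub>i \<rightarrow> B B\<^sub>i\<close> factors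
  through the preserved extension \<open>B R\<close>, which yields \<open>\<tau>\<close> with \<open>B \<epsilon>\<^sub>i \<circ> \<tau> = \<epsilon>\<^sub>i\<^sub>+\<^sub>1\<close>. On the other hand, a
  distributive law \<open>(F, \<lambda>)\<close> determines exactly one natural \<open>\<alpha> : F A\<^sub>i \<rightarrow> B\<^sub>i\<close> with
  \<open>\<alpha>\<^sub>i\<^sub>+\<^sub>1 = B \<alpha>\<^sub>i \<circ> \<lambda>\<close>, by transfinite recursion: at zero and at limits \<open>\<alpha>\<close> is forced by the
  universal properties. The maps \<open>\<kappa> : F \<rightarrow> R\<close> correspond to natural \<open>\<alpha>\<close>, and the uniqueness part of
  the universal property of \<open>B R\<close> says that \<open>\<kappa>\<close> is a morphism of \<open>DL\<close> iff the corresponding \<open>\<alpha>\<close>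
  satisfies the successor equation.
\<close>

section \<open>Ordinals\<close>

lemma ozero_le: "ozero \<le> (i::'k::ordinals)"
  unfolding ozero_def by (rule Least_le) simp

lemma less_osucc: "i < osucc (i::'k::ordinals)"
  unfolding osucc_def using no_last_ordinal[of i] by (rule LeastI_ex)

lemma osucc_le: "i < j \<Longrightarrow> osucc i \<le> (j::'k::ordinals)"
  unfolding osucc_def by (rule Least_le)

lemma osucc_le_osucc_iff: "osucc i \<le> osucc j \<longleftrightarrow> i \<le> (j::'k::ordinals)"
  by (meson le_less_trans less_osucc not_less osucc_le)

lemma osucc_eq_osucc_iff: "osucc i = osucc j \<longleftrightarrow> i = (j::'k::ordinals)"
  by (metis order_antisym order_refl osucc_le_osucc_iff)

lemma osucc_neq_ozero: "osucc i \<noteq> (ozero::'k::ordinals)"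
  using less_osucc[of i] ozero_le[of i] by (metis not_less)

lemma ordinal_cases:
  obtains (zero) "j = ozero" | (succ) i where "j = osucc i" | (limit) "limit_ordinal (j::'k::ordinals)"
  unfolding limit_ordinal_def by blast

section \<open>Functors and natural transformations\<close>

lemma homD: "f \<in> hom C x y \<Longrightarrow> f \<in> Arr C \<and> Dom C f = x \<and> Cod C f = y"
  by (simp add: hom_def)

lemma homI: "f \<in> Arr C \<Longrightarrow> f \<in> hom C (Dom C f) (Cod C f)"
  by (simp add: hom_def)

lemma functor_Obj: "is_functor C D F \<Longrightarrow> x \<in> Obj C \<Longrightarrow> fobj F x \<in> Obj D"
  by (auto simp: is_functor_def)

lemma functor_hom:
  "is_functor C D F \<Longrightarrow> f \<in> hom C x y \<Longrightarrow> farr F f \<in> hom D (fobj F x) (fobj F y)"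
  unfolding is_functor_def by (metis homD)

lemma functor_Ident: "is_functor C D F \<Longrightarrow> x \<in> Obj C \<Longrightarrow> farr F (Ident C x) = Ident D (fobj F x)"
  by (auto simp: is_functor_def)

lemma functor_Cmp:
  "is_functor C D F \<Longrightarrow> f \<in> hom C x y \<Longrightarrow> g \<in> hom C y z
    \<Longrightarrow> farr F (Cmp C g f) = Cmp D (farr F g) (farr F f)"
  unfolding is_functor_def by (metis homD)

lemma fobj_functor_comp [simp]: "x \<in> Obj C \<Longrightarrow> fobj (functor_comp C G F) x = fobj G (fobj F x)"
  by (simp add: functor_comp_def compose_def)

lemma farr_functor_comp [simp]: "f \<in> Arr C \<Longrightarrow> farr (functor_comp C G F) f = farr G (farr F f)"
  by (simp add: functor_comp_def compose_def)

lemma (in category) is_functor_comp: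
  assumes F: "is_functor C D F" and G: "is_functor D E G"
  shows "is_functor C E (functor_comp C G F)"
proof -
  have "fobj (functor_comp C G F) \<in> Obj C \<rightarrow>\<^sub>E Obj E"
    using F G by (auto simp: functor_comp_def compose_def intro!: functor_Obj)
  moreover have hom: "farr G (farr F f) \<in> hom E (fobj G (fobj F x)) (fobj G (fobj F y))"
    if "f \<in> hom C x y" for f x y
    using that F G by (intro functor_hom)
  then have "farr (functor_comp C G F) \<in> Arr C \<rightarrow>\<^sub>E Arr E"
    by (auto simp: functor_comp_def compose_def dest: homI homD)
  moreover have "farr (functor_comp C G F) f
      \<in> hom E (fobj (functor_comp C G F) (Dom C f)) (fobj (functor_comp C G F) (Cod C f))"
    if "f \<in> Arr C" for f
    using hom[OF homI[OF that]] that by (simp add: Dom_in_Obj Cod_in_Obj)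
  moreover have "farr (functor_comp C G F) (Ident C x) = Ident E (fobj (functor_comp C G F) x)"
    if "x \<in> Obj C" for x
    using that Id_in_hom[OF that] F G
    by (simp add: homD[of "Ident C x" C x x] functor_Ident functor_Obj)
  moreover have "farr (functor_comp C G F) (Cmp C g f)
      = Cmp E (farr (functor_comp C G F) g) (farr (functor_comp C G F) f)"
    if "f \<in> Arr C" "g \<in> Arr C" "Cod C f = Dom C g" for f g
  proof -
    have f: "f \<in> hom C (Dom C f) (Cod C f)" and g: "g \<in> hom C (Cod C f) (Cod C g)"
      using that by (simp_all add: hom_def)
    show ?thesis
      using that homD[OF Cmp_in_hom[OF f g]]
      by (simp add: functor_Cmp[OF F f g] functor_Cmp[OF G functor_hom[OF F f] functor_hom[OF F g]])
  qed
  ultimately show ?thesis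
    unfolding is_functor_def by blast
qed

text \<open>Composites are cut off outside the source of the inner functor. Since \<open>F\<close>
  takes values in \<open>D\<close>, the cut-off of \<open>functor_comp D H G\<close> outside
  \<open>D\<close> never bites, and the two sides agree literally.\<close>

lemma (in category) functor_comp_assoc:
  assumes "is_functor C D F"
  shows "functor_comp C (functor_comp D H G) F = functor_comp C H (functor_comp C G F)"
proof -
  have "fobj F x \<in> Obj D" if "x \<in> Obj C" for x
    using assms that by (rule functor_Obj)
  moreover have "farr F f \<in> Arr D" if "f \<in> Arr C" for f
    using functor_hom[OF assms homI[OF that]] by (simp add: hom_def)
  ultimately show ?thesis
    by (auto simp: functor_comp_def compose_def fun_eq_iff)
qed

section \<open>Natural transformations: vertical composition and whiskering\<close>

lemma nat_transD:
  assumes "nat_trans C D F G \<tau>"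
  shows "is_functor C D F" and "is_functor C D G"
    and "x \<in> Obj C \<Longrightarrow> \<tau> x \<in> hom D (fobj F x) (fobj G x)"
    and "f \<in> hom C x y \<Longrightarrow> Cmp D (\<tau> y) (farr F f) = Cmp D (farr G f) (\<tau> x)"
    and "\<tau> \<in> extensional (Obj C)"
  using assms by (auto simp: nat_trans_def PiE_def hom_def)

lemma (in category) nat_transI:
  assumes "is_functor C D F" and "is_functor C D G"
    and "\<And>x. x \<in> Obj C \<Longrightarrow> \<tau> x \<in> hom D (fobj F x) (fobj G x)"
    and "\<And>f x y. f \<in> hom C x y \<Longrightarrow> x \<in> Obj C \<Longrightarrow> y \<in> Obj C
      \<Longrightarrow> Cmp D (\<tau> y) (farr F f) = Cmp D (farr G f) (\<tau> x)"
    and "\<tau> \<in> extensional (Obj C)"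
  shows "nat_trans C D F G \<tau>"
proof -
  have "Cmp D (\<tau> (Cod C f)) (farr F f) = Cmp D (farr G f) (\<tau> (Dom C f))" if "f \<in> Arr C" for f
    using assms(4)[OF homI] that Dom_in_Obj Cod_in_Obj by blast
  then show ?thesis
    using assms(1,2,3,5) by (auto simp: nat_trans_def PiE_def)
qed

lemma (in category) nat_trans_vcomp:
  assumes "category D" and \<tau>: "nat_trans C D F G \<tau>" and \<sigma>: "nat_trans C D G H \<sigma>"
  shows "nat_trans C D F H (vcomp C D \<sigma> \<tau>)"
proof (rule nat_transI)
  interpret D: category D by fact
  show "is_functor C D F" "is_functor C D H"
    using \<tau> \<sigma> by (auto dest: nat_transD)
  show "vcomp C D \<sigma> \<tau> x \<in> hom D (fobj F x) (fobj H x)" if "x \<in> Obj C" for x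
    using that nat_transD(3)[OF \<tau>] nat_transD(3)[OF \<sigma>] by (auto simp: vcomp_def intro: D.Cmp_in_hom)
  fix f x y assume f: "f \<in> hom C x y" and x: "x \<in> Obj C" and y: "y \<in> Obj C"
  note t = nat_transD(3)[OF \<tau>] and s = nat_transD(3)[OF \<sigma>]
  have "Cmp D (Cmp D (\<sigma> y) (\<tau> y)) (farr F f) = Cmp D (\<sigma> y) (Cmp D (\<tau> y) (farr F f))"
    by (rule D.Cmp_assoc[symmetric, OF functor_hom[OF nat_transD(1)[OF \<tau>] f] t[OF y] s[OF y]])
  also have "\<dots> = Cmp D (\<sigma> y) (Cmp D (farr G f) (\<tau> x))"
    by (simp only: nat_transD(4)[OF \<tau> f])
  also have "\<dots> = Cmp D (Cmp D (\<sigma> y) (farr G f)) (\<tau> x)"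
    by (rule D.Cmp_assoc[OF t[OF x] functor_hom[OF nat_transD(2)[OF \<tau>] f] s[OF y]])
  also have "\<dots> = Cmp D (Cmp D (farr H f) (\<sigma> x)) (\<tau> x)"
    by (simp only: nat_transD(4)[OF \<sigma> f])
  also have "\<dots> = Cmp D (farr H f) (Cmp D (\<sigma> x) (\<tau> x))"
    by (rule D.Cmp_assoc[symmetric, OF t[OF x] s[OF x] functor_hom[OF nat_transD(2)[OF \<sigma>] f]])
  finally show "Cmp D (vcomp C D \<sigma> \<tau> y) (farr F f) = Cmp D (farr H f) (vcomp C D \<sigma> \<tau> x)"
    using x y by (simp add: vcomp_def)
qed (simp add: vcomp_def)

lemma (in category) nat_trans_whisker_right:
  assumes F: "is_functor C D F" and \<tau>: "nat_trans D E G H \<tau>"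
  shows "nat_trans C E (functor_comp C G F) (functor_comp C H F) (whisker_right C \<tau> F)"
proof (rule nat_transI)
  show "is_functor C E (functor_comp C G F)" "is_functor C E (functor_comp C H F)"
    using is_functor_comp[OF F] nat_transD(1,2)[OF \<tau>] by blast+
  show "whisker_right C \<tau> F x \<in> hom E (fobj (functor_comp C G F) x) (fobj (functor_comp C H F) x)"
    if "x \<in> Obj C" for x
    using that nat_transD(3)[OF \<tau> functor_Obj[OF F that]] by (simp add: whisker_right_def)
  show "Cmp E (whisker_right C \<tau> F y) (farr (functor_comp C G F) f)
      = Cmp E (farr (functor_comp C H F) f) (whisker_right C \<tau> F x)"
    if "f \<in> hom C x y" "x \<in> Obj C" "y \<in> Obj C" for f x y
    using that nat_transD(4)[OF \<tau> functor_hom[OF F that(1)]] homD[OF that(1)]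
    by (simp add: whisker_right_def)
qed (simp add: whisker_right_def)

lemma (in category) nat_trans_whisker_left:
  assumes K: "is_functor D E K" and \<tau>: "nat_trans C D G H \<tau>"
  shows "nat_trans C E (functor_comp C K G) (functor_comp C K H) (whisker_left C K \<tau>)"
proof (rule nat_transI)
  note G = nat_transD(1)[OF \<tau>] and H = nat_transD(2)[OF \<tau>] and t = nat_transD(3)[OF \<tau>]
  show "is_functor C E (functor_comp C K G)" "is_functor C E (functor_comp C K H)"
    using is_functor_comp[OF _ K] G H by blast+
  show "whisker_left C K \<tau> x \<in> hom E (fobj (functor_comp C K G) x) (fobj (functor_comp C K H) x)"
    if "x \<in> Obj C" for x
    using that functor_hom[OF K t[OF that]] by (simp add: whisker_left_def)
  show "Cmp E (whisker_left C K \<tau> y) (farr (functor_comp C K G) f)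
      = Cmp E (farr (functor_comp C K H) f) (whisker_left C K \<tau> x)"
    if "f \<in> hom C x y" "x \<in> Obj C" "y \<in> Obj C" for f x y
    using that nat_transD(4)[OF \<tau> that(1)] homD[OF that(1)]
      functor_Cmp[OF K functor_hom[OF G that(1)] t[OF that(3)]]
      functor_Cmp[OF K t[OF that(2)] functor_hom[OF H that(1)]]
    by (simp add: whisker_left_def)
qed (simp add: whisker_left_def)

section \<open>Final sequences\<close>

lemma ord_op_simps [simp]:
  "Obj (ord_op I) = I" "(j, i) \<in> Arr (ord_op I) \<longleftrightarrow> j \<in> I \<and> i \<in> I \<and> i \<le> j"
  "Dom (ord_op I) = fst" "Cod (ord_op I) = snd"
  "Ident (ord_op I) i = (i, i)" "Cmp (ord_op I) g f = (fst f, snd g)"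
  by (simp_all add: ord_op_def)

lemma hom_ord_op: "hom (ord_op I) j i = {f. f = (j, i) \<and> j \<in> I \<and> i \<in> I \<and> i \<le> j}"
  by (auto simp: hom_def)

lemma category_ord_op: "category (ord_op I)"
  by unfold_locales (auto simp: hom_ord_op)

section \<open>Universal properties of a final sequence in pointwise form\<close>

locale final_seq = category C
  for C :: "('o, 'm) cat" +
  fixes B :: "('o, 'm, 'o, 'm) fct" and S :: "('k::ordinals, 'k \<times> 'k, 'o, 'm) fct"
  assumes functor_B: "is_functor C C B" and final_sequence: "final_sequence C B S"
begin

lemma functor_S: "is_functor (ord_op UNIV) C S"
  using final_sequence by (simp add: final_sequence_def)

lemma S_Obj: "fobj S i \<in> Obj C"
  using functor_Obj[OF functor_S] by simp

lemma S_hom: "i \<le> j \<Longrightarrow> farr S (j, i) \<in> hom C (fobj S j) (fobj S i)"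
  using functor_hom[OF functor_S, of "(j, i)"] by (simp add: hom_ord_op)

lemma S_refl: "farr S (i, i) = Ident C (fobj S i)"
  using functor_Ident[OF functor_S, of i] by simp

lemma S_trans: "i \<le> j \<Longrightarrow> j \<le> k \<Longrightarrow> Cmp C (farr S (j, i)) (farr S (k, j)) = farr S (k, i)"
  using functor_Cmp[OF functor_S, of "(k, j)" k j "(j, i)" i] by (simp add: hom_ord_op)

lemma S_osucc: "fobj S (osucc i) = fobj B (fobj S i)"
  and S_osucc_osucc: "i \<le> j \<Longrightarrow> farr S (osucc j, osucc i) = farr B (farr S (j, i))"
  using final_sequence by (auto simp: final_sequence_def)

lemma S_ozero_final: "final_object C (fobj S ozero)"
  using final_sequence by (simp add: final_sequence_def)

lemma S_ozero_eq:
  assumes "f \<in> hom C x (fobj S ozero)" and "g \<in> hom C x (fobj S ozero)"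
  shows "f = g"
  using assms S_ozero_final Dom_in_Obj[of f] unfolding final_object_def by (metis homD)

text \<open>The limit clause of \<open>final_sequence\<close> freed from restrictions:
  \<open>s\<close> may be arbitrary from \<open>j\<close> on, and only its values below
  \<open>j\<close> have to form a cone.\<close>

lemma S_limit:
  assumes j: "limit_ordinal j" and d: "d \<in> Obj C"
    and hom: "\<And>i. i < j \<Longrightarrow> s i \<in> hom C d (fobj S i)"
    and cone: "\<And>i k. i \<le> k \<Longrightarrow> k < j \<Longrightarrow> Cmp C (farr S (k, i)) (s k) = s i"
  shows "\<exists>!h. h \<in> hom C d (fobj S j) \<and> (\<forall>i<j. Cmp C (farr S (j, i)) h = s i)"
proof -
  let ?J = "ord_op {..<j}"
  have "is_cone ?J C (restrict_functor ?J S) d (restrict s {..<j})"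
    using d hom cone by (auto simp: is_cone_def restrict_functor_def)
  moreover have "is_limit ?J C (restrict_functor ?J S) (fobj S j) (\<lambda>i\<in>{..<j}. farr S (j, i))"
    using j final_sequence by (simp add: final_sequence_def)
  ultimately have "\<exists>!h. h \<in> hom C d (fobj S j) \<and>
      (\<forall>i\<in>Obj ?J. Cmp C ((\<lambda>i\<in>{..<j}. farr S (j, i)) i) h = restrict s {..<j} i)"
    unfolding is_limit_def by blast
  then show ?thesis
    by (simp add: Ball_def)
qed

text \<open>The projections out of a limit stage are jointly monic: the composites of
  \<open>f\<close> with them form a cone, for which both \<open>f\<close> and \<open>g\<close> are
  mediating maps.\<close>

lemma S_limit_eq:
  assumes j: "limit_ordinal j"
    and f: "f \<in> hom C d (fobj S j)" and g: "g \<in> hom C d (fobj S j)"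
    and eq: "\<And>i. i < j \<Longrightarrow> Cmp C (farr S (j, i)) f = Cmp C (farr S (j, i)) g"
  shows "f = g"
proof -
  have "\<exists>!h. h \<in> hom C d (fobj S j) \<and> (\<forall>i<j. Cmp C (farr S (j, i)) h = Cmp C (farr S (j, i)) f)"
  proof (rule S_limit[OF j])
    show "d \<in> Obj C"
      using homD[OF f] Dom_in_Obj by auto
    show "Cmp C (farr S (j, i)) f \<in> hom C d (fobj S i)" if "i < j" for i
      by (rule Cmp_in_hom[OF f S_hom[OF less_imp_le[OF that]]])
    show "Cmp C (farr S (k, i)) (Cmp C (farr S (j, k)) f) = Cmp C (farr S (j, i)) f"
      if "i \<le> k" "k < j" for i k
      using Cmp_assoc[OF f S_hom[OF less_imp_le] S_hom, of k i] S_trans[of i k j] that by simp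
  qed
  then show ?thesis
    using f g eq by metis
qed

end

section \<open>Distributive laws and final sequences\<close>

locale distributive_law = A: final_seq \<A> A Abar + C: final_seq \<C> B Bbar
  for \<A> :: "('oa, 'ma) cat" and A :: "('oa, 'ma, 'oa, 'ma) fct"
    and Abar :: "('k::ordinals, 'k \<times> 'k, 'oa, 'ma) fct"
    and \<C> :: "('oc, 'mc) cat" and B :: "('oc, 'mc, 'oc, 'mc) fct"
    and Bbar :: "('k, 'k \<times> 'k, 'oc, 'mc) fct" +
  fixes F :: "('oa, 'ma, 'oc, 'mc) fct" and lam :: "'oa \<Rightarrow> 'mc"
  assumes functor_F: "is_functor \<A> \<C> F"
    and lam: "nat_trans \<A> \<C> (functor_comp \<A> F A) (functor_comp \<A> B F) lam"
begin

abbreviation FA :: "'k \<Rightarrow> 'oc" where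
  "FA i \<equiv> fobj F (fobj Abar i)"

lemma FA_Obj: "FA i \<in> Obj \<C>"
  by (rule functor_Obj[OF functor_F A.S_Obj])

lemma FA_hom: "i \<le> j \<Longrightarrow> farr F (farr Abar (j, i)) \<in> hom \<C> (FA j) (FA i)"
  by (rule functor_hom[OF functor_F A.S_hom])

lemma FA_refl: "farr F (farr Abar (i, i)) = Ident \<C> (FA i)"
  by (simp add: A.S_refl functor_Ident[OF functor_F A.S_Obj])

lemma FA_trans:
  "i \<le> j \<Longrightarrow> j \<le> k \<Longrightarrow> Cmp \<C> (farr F (farr Abar (j, i))) (farr F (farr Abar (k, j))) = farr F (farr Abar (k, i))"
  using functor_Cmp[OF functor_F A.S_hom A.S_hom, of j k i] A.S_trans[of i j k] by simp

lemma lam_hom: "lam (fobj Abar i) \<in> hom \<C> (FA (osucc i)) (fobj B (FA i))"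
  using nat_transD(3)[OF lam A.S_Obj, of i] by (simp add: A.S_Obj A.S_osucc)

lemma lam_natural:
  assumes "i \<le> j"
  shows "Cmp \<C> (lam (fobj Abar i)) (farr F (farr Abar (osucc j, osucc i)))
    = Cmp \<C> (farr B (farr F (farr Abar (j, i)))) (lam (fobj Abar j))"
  using nat_transD(4)[OF lam A.S_hom[OF assms]] homD[OF A.S_hom[OF assms]]
  by (simp add: A.S_osucc_osucc[OF assms])

text \<open>The value at \<open>osucc i\<close> forced by the value at \<open>i\<close>. It is well
  typed because final sequences satisfy the successor equation as an equality of objects, not just
  up to isomorphism.\<close>

definition succ_map :: "('k \<Rightarrow> 'mc) \<Rightarrow> 'k \<Rightarrow> 'mc" where
  "succ_map \<alpha> i = Cmp \<C> (farr B (\<alpha> i)) (lam (fobj Abar i))"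

lemma succ_map_hom:
  assumes "\<alpha> i \<in> hom \<C> (FA i) (fobj Bbar i)"
  shows "succ_map \<alpha> i \<in> hom \<C> (FA (osucc i)) (fobj Bbar (osucc i))"
  unfolding succ_map_def C.S_osucc
  by (rule C.Cmp_in_hom[OF lam_hom functor_hom[OF C.functor_B assms]])

text \<open>The square for \<open>\<alpha>\<close> at the arrow from \<open>j\<close> to
  \<open>i\<close> is mapped by \<open>B\<close> and pasted onto the naturality square of
  \<open>lam\<close> at the same arrow of \<open>Abar\<close>.\<close>

lemma succ_map_natural:
  assumes le: "i \<le> j"
    and i: "\<alpha> i \<in> hom \<C> (FA i) (fobj Bbar i)" and j: "\<alpha> j \<in> hom \<C> (FA j) (fobj Bbar j)"
    and nat: "Cmp \<C> (farr Bbar (j, i)) (\<alpha> j) = Cmp \<C> (\<alpha> i) (farr F (farr Abar (j, i)))"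
  shows "Cmp \<C> (farr Bbar (osucc j, osucc i)) (succ_map \<alpha> j)
    = Cmp \<C> (succ_map \<alpha> i) (farr F (farr Abar (osucc j, osucc i)))"
proof -
  note B = C.functor_B
  have le': "osucc i \<le> osucc j"
    using le by (simp add: osucc_le_osucc_iff)
  have "Cmp \<C> (farr Bbar (osucc j, osucc i)) (succ_map \<alpha> j)
      = Cmp \<C> (Cmp \<C> (farr B (farr Bbar (j, i))) (farr B (\<alpha> j))) (lam (fobj Abar j))"
    unfolding succ_map_def C.S_osucc_osucc[OF le]
    by (rule C.Cmp_assoc[OF lam_hom functor_hom[OF B j] functor_hom[OF B C.S_hom[OF le]]])
  also have "\<dots> = Cmp \<C> (farr B (Cmp \<C> (farr Bbar (j, i)) (\<alpha> j))) (lam (fobj Abar j))"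
    by (simp only: functor_Cmp[OF B j C.S_hom[OF le]])
  also have "\<dots> = Cmp \<C> (Cmp \<C> (farr B (\<alpha> i)) (farr B (farr F (farr Abar (j, i))))) (lam (fobj Abar j))"
    by (simp only: nat functor_Cmp[OF B FA_hom[OF le] i])
  also have "\<dots> = Cmp \<C> (farr B (\<alpha> i)) (Cmp \<C> (farr B (farr F (farr Abar (j, i)))) (lam (fobj Abar j)))"
    by (rule C.Cmp_assoc[symmetric, OF lam_hom functor_hom[OF B FA_hom[OF le]] functor_hom[OF B i]])
  also have "\<dots> = Cmp \<C> (farr B (\<alpha> i)) (Cmp \<C> (lam (fobj Abar i)) (farr F (farr Abar (osucc j, osucc i))))"
    by (simp only: lam_natural[OF le])
  also have "\<dots> = Cmp \<C> (succ_map \<alpha> i) (farr F (farr Abar (osucc j, osucc i)))"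
    unfolding succ_map_def by (rule C.Cmp_assoc[OF FA_hom[OF le'] lam_hom functor_hom[OF B i]])
  finally show ?thesis .
qed

text \<open>
  \<open>stage \<alpha> j h\<close>: the map \<open>h\<close> is an admissible value of \<open>\<alpha>\<close> at \<open>j\<close>, given the values of \<open>\<alpha>\<close> below \<open>j\<close>.
\<close>

definition stage :: "('k \<Rightarrow> 'mc) \<Rightarrow> 'k \<Rightarrow> 'mc \<Rightarrow> bool" where
  "stage \<alpha> j h \<longleftrightarrow> h \<in> hom \<C> (FA j) (fobj Bbar j) \<and>
     (\<forall>i<j. Cmp \<C> (farr Bbar (j, i)) h = Cmp \<C> (\<alpha> i) (farr F (farr Abar (j, i)))) \<and>
     (\<forall>i. j = osucc i \<longrightarrow> h = succ_map \<alpha> i)"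

section \<open>Transfinite construction of a family of stages\<close>

lemma stage_hom: "stage \<alpha> i (\<alpha> i) \<Longrightarrow> \<alpha> i \<in> hom \<C> (FA i) (fobj Bbar i)"
  by (simp add: stage_def)

lemma stage_natural:
  assumes j: "stage \<alpha> j (\<alpha> j)" and le: "i \<le> j"
  shows "Cmp \<C> (farr Bbar (j, i)) (\<alpha> j) = Cmp \<C> (\<alpha> i) (farr F (farr Abar (j, i)))"
proof (cases "i = j")
  case True
  then show ?thesis
    by (simp add: C.S_refl FA_refl C.Cmp_Id_left[OF stage_hom[OF j]] C.Cmp_Id_right[OF stage_hom[OF j]])
next
  case False
  then show ?thesis
    using assms by (simp add: stage_def)
qed

text \<open>\<open>B\<close> and \<open>lam\<close> control only arrows between successors, so the
  squares from \<open>osucc j\<close> down to an arbitrary \<open>i \<le> j\<close> need an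
  induction on \<open>i\<close>: finality at zero, \<open>succ_map_natural\<close> at successors,
  joint monicity of the projections at limits.\<close>

lemma stage_osucc:
  assumes below: "\<And>i. i \<le> j \<Longrightarrow> stage \<alpha> i (\<alpha> i)"
  shows "stage \<alpha> (osucc j) (succ_map \<alpha> j)"
proof -
  let ?h = "succ_map \<alpha> j"
  have h: "?h \<in> hom \<C> (FA (osucc j)) (fobj Bbar (osucc j))"
    by (rule succ_map_hom[OF stage_hom[OF below]]) simp
  have "Cmp \<C> (farr Bbar (osucc j, i)) ?h = Cmp \<C> (\<alpha> i) (farr F (farr Abar (osucc j, i)))"
    if "i \<le> j" for i
    using that
  proof (induction i rule: less_induct)
    case (less i)
    have le: "i \<le> osucc j"
      using less.prems less_osucc[of j] by simp
    note \<alpha>i = stage_hom[OF below[OF less.prems]]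
    have L: "Cmp \<C> (farr Bbar (osucc j, i)) ?h \<in> hom \<C> (FA (osucc j)) (fobj Bbar i)"
      by (rule C.Cmp_in_hom[OF h C.S_hom[OF le]])
    have R: "Cmp \<C> (\<alpha> i) (farr F (farr Abar (osucc j, i))) \<in> hom \<C> (FA (osucc j)) (fobj Bbar i)"
      by (rule C.Cmp_in_hom[OF FA_hom[OF le] \<alpha>i])
    show ?case
    proof (cases i rule: ordinal_cases)
      case zero
      then show ?thesis
        using C.S_ozero_eq L R by blast
    next
      case (succ k)
      then have k: "k \<le> j"
        using le by (simp add: osucc_le_osucc_iff)
      \<comment> \<open>The stage at \<open>i\<close> has the prescribed successor form, so the
        square to be checked is the shift of the one from \<open>j\<close> to
        \<open>k\<close>.\<close>
      have "\<alpha> i = succ_map \<alpha> k"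
        using below[OF less.prems] succ by (simp add: stage_def)
      then show ?thesis
        using succ_map_natural[where \<alpha> = \<alpha>, OF k stage_hom[OF below[OF k]] stage_hom[OF below[OF order_refl]]
            stage_natural[OF below[OF order_refl] k]] succ
        by simp
    next
      case limit
      show ?thesis
      proof (rule C.S_limit_eq[OF limit L R])
        \<comment> \<open>After projection to \<open>l\<close>, the left side falls under the
          induction hypothesis for \<open>l\<close>, and the right side unfolds by naturality of the
          stage at \<open>i\<close>.\<close>
        fix l assume l: "l < i"
        then have li: "l \<le> i" and lj: "l \<le> j"
          using less.prems by simp_all
        have "Cmp \<C> (farr Bbar (i, l)) (Cmp \<C> (farr Bbar (osucc j, i)) ?h) = Cmp \<C> (farr Bbar (osucc j, l)) ?h"
          using C.Cmp_assoc[OF h C.S_hom[OF le] C.S_hom[OF li]] C.S_trans[OF li le] by simp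
        also have "\<dots> = Cmp \<C> (\<alpha> l) (farr F (farr Abar (osucc j, l)))"
          by (rule less.IH[OF l lj])
        also have "\<dots> = Cmp \<C> (Cmp \<C> (\<alpha> l) (farr F (farr Abar (i, l)))) (farr F (farr Abar (osucc j, i)))"
          using C.Cmp_assoc[OF FA_hom[OF le] FA_hom[OF li] stage_hom[OF below[OF lj]]] FA_trans[OF li le]
          by simp
        also have "\<dots> = Cmp \<C> (Cmp \<C> (farr Bbar (i, l)) (\<alpha> i)) (farr F (farr Abar (osucc j, i)))"
          by (simp only: stage_natural[OF below[OF less.prems] li])
        also have "\<dots> = Cmp \<C> (farr Bbar (i, l)) (Cmp \<C> (\<alpha> i) (farr F (farr Abar (osucc j, i))))"
          by (rule C.Cmp_assoc[symmetric, OF FA_hom[OF le] \<alpha>i C.S_hom[OF li]])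
        finally show "Cmp \<C> (farr Bbar (i, l)) (Cmp \<C> (farr Bbar (osucc j, i)) ?h)
          = Cmp \<C> (farr Bbar (i, l)) (Cmp \<C> (\<alpha> i) (farr F (farr Abar (osucc j, i))))" .
      qed
    qed
  qed
  then have "\<forall>i<osucc j. Cmp \<C> (farr Bbar (osucc j, i)) ?h = Cmp \<C> (\<alpha> i) (farr F (farr Abar (osucc j, i)))"
    by (metis not_less osucc_le)
  \<comment> \<open>Injectivity of \<open>osucc\<close> leaves \<open>j\<close> as the only
    predecessor in the successor clause of \<open>stage\<close>, where it holds by
    reflexivity.\<close>
  with h show ?thesis
    by (simp add: stage_def osucc_eq_osucc_iff)
qed

text \<open>The maps out of \<open>FA j\<close> followed by the earlier \<open>\<alpha> i\<close>
  form a cone, by naturality of the earlier stages; the mediating map is the new value.\<close>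

lemma stage_limit:
  assumes j: "limit_ordinal j" and below: "\<And>i. i < j \<Longrightarrow> stage \<alpha> i (\<alpha> i)"
  shows "\<exists>h. stage \<alpha> j h"
proof -
  have "\<exists>!h. h \<in> hom \<C> (FA j) (fobj Bbar j) \<and>
      (\<forall>i<j. Cmp \<C> (farr Bbar (j, i)) h = Cmp \<C> (\<alpha> i) (farr F (farr Abar (j, i))))"
  proof (rule C.S_limit[OF j FA_Obj])
    show "Cmp \<C> (\<alpha> i) (farr F (farr Abar (j, i))) \<in> hom \<C> (FA j) (fobj Bbar i)" if "i < j" for i
      using that by (intro C.Cmp_in_hom[OF FA_hom stage_hom[OF below]]) simp_all
    fix i k assume ik: "i \<le> k" and k: "k < j"
    then have i: "i < j" and kj: "k \<le> j"
      by simp_all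
    show "Cmp \<C> (farr Bbar (k, i)) (Cmp \<C> (\<alpha> k) (farr F (farr Abar (j, k))))
        = Cmp \<C> (\<alpha> i) (farr F (farr Abar (j, i)))"
      using C.Cmp_assoc[OF FA_hom[OF kj] stage_hom[OF below[OF k]] C.S_hom[OF ik]]
        C.Cmp_assoc[OF FA_hom[OF kj] FA_hom[OF ik] stage_hom[OF below[OF i]]]
        stage_natural[OF below[OF k] ik] FA_trans[OF ik kj]
      by simp
  qed
  \<comment> \<open>A limit ordinal is no successor, so the last clause of \<open>stage\<close> is
    vacuous.\<close>
  then show ?thesis
    using j by (auto simp: stage_def limit_ordinal_def)
qed

lemma stage_ozero: "\<exists>h. stage \<alpha> ozero h"
proof -
  obtain h where "h \<in> hom \<C> (FA ozero) (fobj Bbar ozero)"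
    using C.S_ozero_final FA_Obj unfolding final_object_def by blast
  \<comment> \<open>No ordinal lies below \<open>ozero\<close> and it is no successor, so only the
    typing clause of \<open>stage\<close> is left.\<close>
  then have "stage \<alpha> ozero h"
    using ozero_le osucc_neq_ozero by (auto simp: stage_def not_less[symmetric] dest: sym)
  then show ?thesis ..
qed

text \<open>Well-founded dependent choice: it suffices that admissibility at \<open>j\<close>
  depends only on values below \<open>j\<close>, and that an admissible value exists whenever all
  earlier ones are admissible.\<close>

lemma ex_stages: "\<exists>\<alpha>. \<forall>j. stage \<alpha> j (\<alpha> j)"
proof (rule dependent_wf_choice[OF wf])
  show "stage \<alpha> j h = stage \<beta> j h" if below: "\<And>i. (i, j) \<in> {(i, j). i < j} \<Longrightarrow> \<alpha> i = \<beta> i" for \<alpha> \<beta> j h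
  proof -
    \<comment> \<open>\<open>succ_map \<alpha> i\<close> reads \<open>\<alpha>\<close> at
      \<open>i\<close> alone, which lies below \<open>j = osucc i\<close>.\<close>
    have "succ_map \<alpha> i = succ_map \<beta> i" if "j = osucc i" for i
      using below[of i] that less_osucc[of i]
      by (simp add: succ_map_def)
    moreover have "\<alpha> i = \<beta> i" if "i < j" for i
      using below that by simp
    ultimately show ?thesis
      unfolding stage_def by (metis (no_types))
  qed
  show "\<exists>h. stage \<alpha> j h" if below: "\<And>i. (i, j) \<in> {(i, j). i < j} \<Longrightarrow> stage \<alpha> i (\<alpha> i)" for j \<alpha>
  proof (cases j rule: ordinal_cases)
    case zero
    then show ?thesis
      using stage_ozero by simp
  next
    case (succ k)
    have "stage \<alpha> i (\<alpha> i)" if "i \<le> k" for i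
      using below that less_osucc[of k] succ by simp
    then show ?thesis
      using stage_osucc succ by blast
  next
    case limit
    then show ?thesis
      using stage_limit below by simp
  qed
qed

text \<open>These families will be matched with the \<open>DL\<close> morphisms from
  \<open>(F, lam)\<close> into the Kan extension; \<open>stage\<close> is the same condition one
  ordinal at a time.\<close>

definition compatible :: "('k \<Rightarrow> 'mc) \<Rightarrow> bool" where
  "compatible \<alpha> \<longleftrightarrow> nat_trans (ord_op UNIV) \<C> (functor_comp (ord_op UNIV) F Abar) Bbar \<alpha> \<and>
     (\<forall>i. \<alpha> (osucc i) = succ_map \<alpha> i)"

lemma compatible_stage:
  assumes "compatible \<alpha>"
  shows "stage \<alpha> j (\<alpha> j)"
proof -
  have nat: "nat_trans (ord_op UNIV) \<C> (functor_comp (ord_op UNIV) F Abar) Bbar \<alpha>"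
    using assms by (simp add: compatible_def)
  have "Cmp \<C> (farr Bbar (j, i)) (\<alpha> j) = Cmp \<C> (\<alpha> i) (farr F (farr Abar (j, i)))" if "i < j" for i
    using nat_transD(4)[OF nat, of "(j, i)" j i] that by (simp add: hom_ord_op)
  then show ?thesis
    using assms nat_transD(3)[OF nat, of j] by (simp add: stage_def compatible_def)
qed

lemma ex_compatible: "\<exists>\<alpha>. compatible \<alpha>"
proof -
  obtain \<alpha> where \<alpha>: "\<And>j. stage \<alpha> j (\<alpha> j)"
    using ex_stages by blast
  have "nat_trans (ord_op UNIV) \<C> (functor_comp (ord_op UNIV) F Abar) Bbar \<alpha>"
  proof (rule category.nat_transI[OF category_ord_op])
    show "is_functor (ord_op UNIV) \<C> (functor_comp (ord_op UNIV) F Abar)"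
      by (rule category.is_functor_comp[OF category_ord_op A.functor_S functor_F])
    show "is_functor (ord_op UNIV) \<C> Bbar"
      by (rule C.functor_S)
  qed (auto simp: stage_hom[OF \<alpha>] stage_natural[OF \<alpha>] hom_ord_op)
  moreover have "\<alpha> (osucc i) = succ_map \<alpha> i" for i
    using \<alpha>[of "osucc i"] by (simp add: stage_def)
  ultimately show ?thesis
    by (auto simp: compatible_def)
qed

text \<open>Each value is forced by the earlier ones: by finality at zero, by the successor
  equation, and by joint monicity of the projections at limits.\<close>

lemma compatible_unique:
  assumes "compatible \<alpha>" and "compatible \<beta>"
  shows "\<alpha> = \<beta>"
proof
  fix j
  show "\<alpha> j = \<beta> j"
  proof (induction j rule: less_induct)
    case (less j)
    note a = compatible_stage[OF assms(1), of j] and b = compatible_stage[OF assms(2), of j]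
    show ?case
    proof (cases j rule: ordinal_cases)
      case zero
      then show ?thesis
        using C.S_ozero_eq stage_hom[OF a] stage_hom[OF b] by blast
    next
      case (succ i)
      then show ?thesis
        using less.IH[of i] less_osucc[of i] assms by (simp add: compatible_def succ_map_def)
    next
      case limit
      then show ?thesis
        using a b less.IH by (intro C.S_limit_eq[OF limit stage_hom[OF a] stage_hom[OF b]]) (simp add: stage_def)
    qed
  qed
qed

end

section \<open>The companion\<close>

locale preserved_kan_extension = A: final_seq \<A> A Abar + C: final_seq \<C> B Bbar
  for \<A> :: "('oa, 'ma) cat" and A :: "('oa, 'ma, 'oa, 'ma) fct"
    and Abar :: "('k::ordinals, 'k \<times> 'k, 'oa, 'ma) fct"
    and \<C> :: "('oc, 'mc) cat" and B :: "('oc, 'mc, 'oc, 'mc) fct"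
    and Bbar :: "('k, 'k \<times> 'k, 'oc, 'mc) fct" +
  fixes R :: "('oa, 'ma, 'oc, 'mc) fct" and \<epsilon> :: "'k \<Rightarrow> 'mc"
  assumes kan: "right_kan_extension (ord_op UNIV) \<A> \<C> Abar Bbar R \<epsilon>"
    and preserved: "preserves_right_kan_extension (ord_op UNIV) \<A> \<C> B Abar Bbar R \<epsilon>"
begin

section \<open>The two universal properties by components, and the construction of
  \<open>\<tau>\<close>\<close>

abbreviation X :: "('k, 'k \<times> 'k) cat" where
  "X \<equiv> ord_op UNIV"

lemma functor_R: "is_functor \<A> \<C> R"
  and counit: "nat_trans X \<C> (functor_comp X R Abar) Bbar \<epsilon>"
  using kan by (simp_all add: right_kan_extension_def)

lemma counit_hom: "\<epsilon> i \<in> hom \<C> (fobj R (fobj Abar i)) (fobj Bbar i)"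
  using nat_transD(3)[OF counit, of i] by simp

text \<open>Every ordinal is an object of \<open>X\<close>, so the restrictions in
  \<open>vcomp\<close> and \<open>whisker_right\<close> are void and the factorization can be stated
  by components.\<close>

lemma kan_factor:
  assumes "is_functor \<A> \<C> H" and "nat_trans X \<C> (functor_comp X H Abar) Bbar \<alpha>"
  shows "\<exists>!\<beta>. nat_trans \<A> \<C> H R \<beta> \<and> (\<forall>i. Cmp \<C> (\<epsilon> i) (\<beta> (fobj Abar i)) = \<alpha> i)"
proof -
  have "\<exists>!\<beta>. nat_trans \<A> \<C> H R \<beta> \<and> vcomp X \<C> \<epsilon> (whisker_right X \<beta> Abar) = \<alpha>"
    using kan assms unfolding right_kan_extension_def by blast
  then show ?thesis
    by (simp add: vcomp_def whisker_right_def fun_eq_iff)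
qed

lemma preserved_factor:
  assumes "is_functor \<A> \<C> H" and "nat_trans X \<C> (functor_comp X H Abar) (functor_comp X B Bbar) \<alpha>"
  shows "\<exists>!\<beta>. nat_trans \<A> \<C> H (functor_comp \<A> B R) \<beta> \<and>
    (\<forall>i. Cmp \<C> (farr B (\<epsilon> i)) (\<beta> (fobj Abar i)) = \<alpha> i)"
proof -
  have "\<exists>!\<beta>. nat_trans \<A> \<C> H (functor_comp \<A> B R) \<beta> \<and>
      vcomp X \<C> (whisker_left X B \<epsilon>) (whisker_right X \<beta> Abar) = \<alpha>"
    using preserved assms unfolding preserves_right_kan_extension_def right_kan_extension_def by blast
  then show ?thesis
    by (simp add: vcomp_def whisker_right_def whisker_left_def fun_eq_iff)
qed

text \<open>The uniqueness half of the preserved universal property: both transformations factor the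
  same family, and the work lies in checking that this family is natural.\<close>

lemma preserved_eqI:
  assumes \<beta>: "nat_trans \<A> \<C> H (functor_comp \<A> B R) \<beta>" and \<gamma>: "nat_trans \<A> \<C> H (functor_comp \<A> B R) \<gamma>"
    and eq: "\<And>i. Cmp \<C> (farr B (\<epsilon> i)) (\<beta> (fobj Abar i)) = Cmp \<C> (farr B (\<epsilon> i)) (\<gamma> (fobj Abar i))"
  shows "\<beta> = \<gamma>"
proof -
  note X = category_ord_op[of "UNIV :: 'k set"]
  let ?\<alpha> = "vcomp X \<C> (whisker_left X B \<epsilon>) (whisker_right X \<beta> Abar)"
  \<comment> \<open>Whiskering ends in \<open>B R\<close> composed with \<open>Abar\<close>;
    reassociated to \<open>B\<close> after \<open>R Abar\<close>, it meets the source of the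
    whiskered counit.\<close>
  have "nat_trans X \<C> (functor_comp X H Abar) (functor_comp X B (functor_comp X R Abar)) (whisker_right X \<beta> Abar)"
    using category.nat_trans_whisker_right[OF X A.functor_S \<beta>]
    by (simp add: category.functor_comp_assoc[OF X A.functor_S])
  then have "nat_trans X \<C> (functor_comp X H Abar) (functor_comp X B Bbar) ?\<alpha>"
    using category.nat_trans_vcomp[OF X C.category_axioms]
      category.nat_trans_whisker_left[OF X C.functor_B counit] by blast
  from preserved_factor[OF nat_transD(1)[OF \<beta>] this]
  have "\<exists>!\<beta>'. nat_trans \<A> \<C> H (functor_comp \<A> B R) \<beta>' \<and>
      (\<forall>i. Cmp \<C> (farr B (\<epsilon> i)) (\<beta>' (fobj Abar i)) = Cmp \<C> (farr B (\<epsilon> i)) (\<beta> (fobj Abar i)))"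
    by (simp add: vcomp_def whisker_right_def whisker_left_def)
  then show ?thesis
    using \<beta> \<gamma> eq by metis
qed

text \<open>Because \<open>Abar\<close> and \<open>Bbar\<close> turn \<open>osucc\<close> into
  \<open>A\<close> and \<open>B\<close>, the shifted counit is a transformation from
  \<open>R A\<close> along \<open>Abar\<close> to \<open>B Bbar\<close>; \<open>\<tau>\<close> is
  its factorization through the preserved extension.\<close>

lemma ex_tau:
  "\<exists>\<tau>. nat_trans \<A> \<C> (functor_comp \<A> R A) (functor_comp \<A> B R) \<tau> \<and>
    (\<forall>i. Cmp \<C> (farr B (\<epsilon> i)) (\<tau> (fobj Abar i)) = \<epsilon> (osucc i))"
proof -
  note X = category_ord_op[of "UNIV :: 'k set"]
  have RA: "is_functor \<A> \<C> (functor_comp \<A> R A)"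
    by (rule A.is_functor_comp[OF A.functor_B functor_R])
  have "nat_trans X \<C> (functor_comp X (functor_comp \<A> R A) Abar) (functor_comp X B Bbar) (\<lambda>i. \<epsilon> (osucc i))"
  proof (rule category.nat_transI[OF X])
    show "is_functor X \<C> (functor_comp X (functor_comp \<A> R A) Abar)"
      by (rule category.is_functor_comp[OF X A.functor_S RA])
    show "is_functor X \<C> (functor_comp X B Bbar)"
      by (rule category.is_functor_comp[OF X C.functor_S C.functor_B])
    show "\<epsilon> (osucc i) \<in> hom \<C> (fobj (functor_comp X (functor_comp \<A> R A) Abar) i) (fobj (functor_comp X B Bbar) i)" for i
      using counit_hom[of "osucc i"] by (simp add: A.S_Obj A.S_osucc C.S_osucc)
    show "Cmp \<C> (\<epsilon> (osucc i)) (farr (functor_comp X (functor_comp \<A> R A) Abar) f)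
        = Cmp \<C> (farr (functor_comp X B Bbar) f) (\<epsilon> (osucc j))"
      if "f \<in> hom X j i" for f j i
    proof -
      from that have f: "f = (j, i)" and le: "i \<le> j"
        by (simp_all add: hom_ord_op)
      \<comment> \<open>Naturality at \<open>(j, i)\<close> is naturality of the counit at the
        shifted arrow.\<close>
      then show ?thesis
        using nat_transD(4)[OF counit, of "(osucc j, osucc i)" "osucc j" "osucc i"] homD[OF A.S_hom[OF le]]
        by (simp add: hom_ord_op osucc_le_osucc_iff A.S_osucc_osucc C.S_osucc_osucc)
    qed
  qed simp
  from preserved_factor[OF RA this] show ?thesis
    by blast
qed

section \<open>Morphisms of \<open>DL\<close> into the Kan extension\<close>

context
  fixes \<tau> F lam
  assumes tau: "nat_trans \<A> \<C> (functor_comp \<A> R A) (functor_comp \<A> B R) \<tau>"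
    and counit_tau: "\<And>i. Cmp \<C> (farr B (\<epsilon> i)) (\<tau> (fobj Abar i)) = \<epsilon> (osucc i)"
    and functor_F: "is_functor \<A> \<C> F"
    and lam: "nat_trans \<A> \<C> (functor_comp \<A> F A) (functor_comp \<A> B F) lam"
begin

interpretation F: distributive_law \<A> A Abar \<C> B Bbar F lam
  by unfold_locales (fact functor_F lam)+

text \<open>Both sides of the \<open>DL\<close> equation are transformations from \<open>F A\<close>
  to \<open>B R\<close>, so \<open>preserved_eqI\<close> lets them be compared after composing with
  \<open>B\<close> of the counit. There the left side becomes the family at \<open>osucc i\<close>,
  by the choice of \<open>\<tau>\<close>, and the right side becomes its
  \<open>succ_map\<close>.\<close>

lemma DL_morphism_iff:
  assumes \<kappa>: "nat_trans \<A> \<C> F R \<kappa>"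
  shows "vcomp \<A> \<C> \<tau> (whisker_right \<A> \<kappa> A) = vcomp \<A> \<C> (whisker_left \<A> B \<kappa>) lam
    \<longleftrightarrow> F.compatible (\<lambda>i. Cmp \<C> (\<epsilon> i) (\<kappa> (fobj Abar i)))" (is "?l = ?r \<longleftrightarrow> F.compatible ?\<alpha>")
proof -
  note X = category_ord_op[of "UNIV :: 'k set"]
  note B = C.functor_B
  have \<kappa>_hom: "\<kappa> (fobj Abar i) \<in> hom \<C> (F.FA i) (fobj R (fobj Abar i))" for i
    by (rule nat_transD(3)[OF \<kappa> A.S_Obj])
  have l: "nat_trans \<A> \<C> (functor_comp \<A> F A) (functor_comp \<A> B R) ?l"
    by (rule A.nat_trans_vcomp[OF C.category_axioms A.nat_trans_whisker_right[OF A.functor_B \<kappa>] tau])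
  have r: "nat_trans \<A> \<C> (functor_comp \<A> F A) (functor_comp \<A> B R) ?r"
    by (rule A.nat_trans_vcomp[OF C.category_axioms lam A.nat_trans_whisker_left[OF B \<kappa>]])
  \<comment> \<open>The family is natural for every natural \<open>\<kappa>\<close>, so
    compatibility reduces to the successor equation.\<close>
  have \<alpha>: "nat_trans X \<C> (functor_comp X F Abar) Bbar ?\<alpha>"
    using category.nat_trans_vcomp[OF X C.category_axioms
        category.nat_trans_whisker_right[OF X A.functor_S \<kappa>] counit]
    by (simp add: vcomp_def whisker_right_def restrict_def)
  have l_eq: "Cmp \<C> (farr B (\<epsilon> i)) (?l (fobj Abar i)) = ?\<alpha> (osucc i)" for i
  proof -
    have "\<tau> (fobj Abar i) \<in> hom \<C> (fobj R (fobj Abar (osucc i))) (fobj B (fobj R (fobj Abar i)))"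
      using nat_transD(3)[OF tau A.S_Obj, of i] by (simp add: A.S_Obj A.S_osucc)
    from C.Cmp_assoc[OF \<kappa>_hom this functor_hom[OF B counit_hom]] show ?thesis
      by (simp add: vcomp_def whisker_right_def A.S_Obj A.S_osucc[symmetric] counit_tau)
  qed
  have r_eq: "Cmp \<C> (farr B (\<epsilon> i)) (?r (fobj Abar i)) = F.succ_map ?\<alpha> i" for i
    using C.Cmp_assoc[OF F.lam_hom functor_hom[OF B \<kappa>_hom] functor_hom[OF B counit_hom], of i]
    by (simp add: vcomp_def whisker_left_def A.S_Obj F.succ_map_def functor_Cmp[OF B \<kappa>_hom counit_hom])
  have "?l = ?r \<longleftrightarrow> (\<forall>i. ?\<alpha> (osucc i) = F.succ_map ?\<alpha> i)"
    using preserved_eqI[OF l r] l_eq r_eq by metis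
  then show ?thesis
    using \<alpha> by (simp add: F.compatible_def)
qed

text \<open>By \<open>DL_morphism_iff\<close> the morphisms are the \<open>\<kappa>\<close> inducing
  a compatible family; there is exactly one such family, and the Kan extension gives exactly one
  \<open>\<kappa>\<close> inducing it.\<close>

lemma ex1_DL_morphism:
  "\<exists>!\<kappa>. nat_trans \<A> \<C> F R \<kappa> \<and>
    vcomp \<A> \<C> \<tau> (whisker_right \<A> \<kappa> A) = vcomp \<A> \<C> (whisker_left \<A> B \<kappa>) lam"
proof -
  obtain \<alpha> where \<alpha>: "F.compatible \<alpha>"
    using F.ex_compatible by blast
  have iff: "F.compatible \<beta> \<longleftrightarrow> (\<forall>i. \<beta> i = \<alpha> i)" for \<beta>
    using \<alpha> F.compatible_unique by (auto simp: fun_eq_iff[symmetric])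
  have "\<exists>!\<kappa>. nat_trans \<A> \<C> F R \<kappa> \<and> (\<forall>i. Cmp \<C> (\<epsilon> i) (\<kappa> (fobj Abar i)) = \<alpha> i)"
    using \<alpha> by (intro kan_factor[OF functor_F]) (simp add: F.compatible_def)
  \<comment> \<open>\<open>DL_morphism_iff\<close> presupposes naturality of
    \<open>\<kappa>\<close>; \<open>conj_cong\<close> makes the first conjunct available when
    rewriting the second.\<close>
  then show ?thesis
    by (simp add: DL_morphism_iff iff cong: conj_cong)
qed

end

lemma ex_companion:
  "\<exists>\<tau>. nat_trans \<A> \<C> (functor_comp \<A> R A) (functor_comp \<A> B R) \<tau> \<and> companion \<A> \<C> A B (R, \<tau>)"
proof -
  obtain \<tau> where \<tau>: "nat_trans \<A> \<C> (functor_comp \<A> R A) (functor_comp \<A> B R) \<tau>"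
    and counit_\<tau>: "\<And>i. Cmp \<C> (farr B (\<epsilon> i)) (\<tau> (fobj Abar i)) = \<epsilon> (osucc i)"
    using ex_tau by blast
  let ?DL = "DL \<A> \<C> A B"
  have Obj_iff: "(F, lam) \<in> Obj ?DL \<longleftrightarrow>
      is_functor \<A> \<C> F \<and> nat_trans \<A> \<C> (functor_comp \<A> F A) (functor_comp \<A> B F) lam" for F lam
    by (simp add: DL_def)
  have R_Obj: "(R, \<tau>) \<in> Obj ?DL"
    using functor_R \<tau> by (simp add: Obj_iff)
  moreover have "\<exists>!f. f \<in> hom ?DL P (R, \<tau>)" if P: "P \<in> Obj ?DL" for P
  proof -
    obtain F lam where P_eq: "P = (F, lam)"
      by (cases P)
    let ?morph = "\<lambda>\<kappa>. nat_trans \<A> \<C> F R \<kappa> \<and>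
      vcomp \<A> \<C> \<tau> (whisker_right \<A> \<kappa> A) = vcomp \<A> \<C> (whisker_left \<A> B \<kappa>) lam"
    \<comment> \<open>Arrows of \<open>DL\<close> record their endpoints; with these fixed, an arrow
      amounts to its middle component, and unique existence transfers.\<close>
    have hom: "hom ?DL P (R, \<tau>) = {(P, \<kappa>, (R, \<tau>)) | \<kappa>. ?morph \<kappa>}"
      using P R_Obj unfolding P_eq Obj_iff by (auto simp: hom_def DL_def)
    have "\<exists>!\<kappa>. ?morph \<kappa>"
      using P unfolding P_eq Obj_iff by (intro ex1_DL_morphism[OF \<tau> counit_\<tau>]) simp_all
    then show ?thesis
      unfolding hom by auto
  qed
  ultimately have "companion \<A> \<C> A B (R, \<tau>)"
    by (simp add: companion_def final_object_def)
  with \<tau> show ?thesis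
    by blast
qed

end

theorem theorem6p3:
  fixes \<A> :: "('oa, 'ma) cat" and \<C> :: "('oc, 'mc) cat"
    and A :: "('oa, 'ma, 'oa, 'ma) fct" and B :: "('oc, 'mc, 'oc, 'mc) fct"
    and Abar :: "('k::ordinals, 'k \<times> 'k, 'oa, 'ma) fct"
    and Bbar :: "('k, 'k \<times> 'k, 'oc, 'mc) fct"
    and R :: "('oa, 'ma, 'oc, 'mc) fct" and \<epsilon> :: "'k \<Rightarrow> 'mc"
  assumes "complete_category TYPE('k) \<A>" and "complete_category TYPE('k) \<C>"
    and "is_functor \<A> \<A> A" and "is_functor \<C> \<C> B"
    and "final_sequence \<A> A Abar" and "final_sequence \<C> B Bbar"
    and "right_kan_extension (ord_op UNIV) \<A> \<C> Abar Bbar R \<epsilon>"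
    and "preserves_right_kan_extension (ord_op UNIV) \<A> \<C> B Abar Bbar R \<epsilon>"
  shows "\<exists>\<tau>. nat_trans \<A> \<C> (functor_comp \<A> R A) (functor_comp \<A> B R) \<tau> \<and> companion \<A> \<C> A B (R, \<tau>)"
proof -
  have "final_seq \<A> A Abar" "final_seq \<C> B Bbar"
    using assms(1-6)
    by (auto simp: complete_category_def final_seq_def final_seq_axioms_def)
  then have "preserved_kan_extension \<A> A Abar \<C> B Bbar R \<epsilon>"
    using assms(7,8) by (simp add: preserved_kan_extension_def preserved_kan_extension_axioms_def)
  then show ?thesis
    by (rule preserved_kan_extension.ex_companion)
qed

end
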